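(* Let $n,t,k\in\mathbb{N}$ be such that $n\ge 2$, $t\ge 3$, and $k<r(B_n,B_n)$. If there exists a $2$-coloring of the edges of $K_k$ that avoids a monochromatic $B_n$ and a monochromatic $K_{1,\lfloor \frac{n+k-1}{2}\rfloor+1}$, then $gr^t_2(B_{n+k})\ge 2k+1$.
   Context: $K_n$ is the complete graph of order $n$, and $K_{1,m}$ is the star with $m$ edges. The book $B_n:=K_2+nK_1$ (graph join) is the graph on $n+2$ vertices consisting of an edge $xy$ (the spine) together with $n$ further, pairwise non-adjacent vertices (the pages), each adjacent to both $x$ and $y$. $r(G_1,G_2)$ is the $2$-color Ramsey number: the least $p$ such that every $2$-coloring of the edges of $K_p$ contains, for some $i\in\{1,2\}$, a monochromatic copy of $G_i$ in color $i$. A $t$-coloring of $K_p$ is a map $f:E(K_p)\to\{1,\dots,t\}$, not assumed surjective. A Gallai $t$-coloring is a $t$-coloring with no rainbow triangle, i.e. there are no three vertices $x,y,z$ such that $f(xy),f(xz),f(yz)$ are pairwise distinct. For $1\le s<t$ and a graph $G$, the weakened Gallai-Ramsey number $gr^t_s(G)$ is the least $p\in\mathbb{N}$ such that every Gallai $t$-coloring of $K_p$ contains a (not necessarily induced) subgraph isomorphic to $G$ whose edges use at most $s$ colors. *)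

theory Defs
  imports "HOL-Library.Ramsey"
begin

record 'a sgraph =
  vertices :: "'a set"
  edges :: "'a set set"

text \<open>The book \<open>K\<^sub>2 + nK\<^sub>1\<close>: the spine is \<open>{0, 1}\<close> and the pages are \<open>2, \<dots>, n + 1\<close>.\<close>

definition book :: "nat \<Rightarrow> nat sgraph" where
  "book n = \<lparr>vertices = {..<n + 2},
             edges = {{0, 1}} \<union> {{x, i} |x i. x \<in> {0, 1} \<and> i \<in> {2..<n + 2}}\<rparr>"

text \<open>The star \<open>K\<close>\<open>\<^bsub>1,m\<^esub>\<close>, with centre \<open>0\<close>.\<close>

definition star :: "nat \<Rightarrow> nat sgraph" where
  "star m = \<lparr>vertices = {..m}, edges = {{0, i} |i. i \<in> {1..m}}\<rparr>"

text \<open>The complete graph on \<open>p\<close> vertices has vertex set \<open>{..<p}\<close>, and its edges are the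
  2-element subsets of this set. Values of a coloring elsewhere are irrelevant.\<close>

definition edge_coloring :: "nat \<Rightarrow> nat \<Rightarrow> (nat set \<Rightarrow> nat) \<Rightarrow> bool" where
  "edge_coloring t p f \<longleftrightarrow> f \<in> [{..<p}]\<^bsup>2\<^esup> \<rightarrow> {1..t}"

definition gallai_coloring :: "nat \<Rightarrow> nat \<Rightarrow> (nat set \<Rightarrow> nat) \<Rightarrow> bool" where
  "gallai_coloring t p f \<longleftrightarrow> edge_coloring t p f \<and>
     \<not> (\<exists>x\<in>{..<p}. \<exists>y\<in>{..<p}. \<exists>z\<in>{..<p}. x \<noteq> y \<and> x \<noteq> z \<and> y \<noteq> z \<and>
          f {x, y} \<noteq> f {x, z} \<and> f {x, y} \<noteq> f {y, z} \<and> f {x, z} \<noteq> f {y, z})"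

text \<open>As the host graph is complete, a (not necessarily induced) copy of \<open>G\<close> is given by any
  injection \<open>\<phi>\<close> of the vertices; the edges of the copy are the images \<open>\<phi> ` e\<close>.\<close>

definition copy_in_complete :: "nat \<Rightarrow> 'a sgraph \<Rightarrow> ('a \<Rightarrow> nat) \<Rightarrow> bool" where
  "copy_in_complete p G \<phi> \<longleftrightarrow> inj_on \<phi> (vertices G) \<and> \<phi> ` vertices G \<subseteq> {..<p}"

definition has_mono_copy :: "nat \<Rightarrow> (nat set \<Rightarrow> nat) \<Rightarrow> nat \<Rightarrow> 'a sgraph \<Rightarrow> bool" where
  "has_mono_copy p f c G \<longleftrightarrow>
     (\<exists>\<phi>. copy_in_complete p G \<phi> \<and> (\<forall>e\<in>edges G. f (\<phi> ` e) = c))"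

definition has_copy_with_at_most :: "nat \<Rightarrow> (nat set \<Rightarrow> nat) \<Rightarrow> nat \<Rightarrow> 'a sgraph \<Rightarrow> bool" where
  "has_copy_with_at_most p f s G \<longleftrightarrow>
     (\<exists>\<phi>. copy_in_complete p G \<phi> \<and> card ((\<lambda>e. f (\<phi> ` e)) ` edges G) \<le> s)"

text \<open>For finite simple graphs the least numbers below exist by Ramsey's theorem
  (see \<open>ramsey_full\<close>), so that \<open>LEAST\<close> is meaningful.\<close>

definition ramsey_number :: "'a sgraph \<Rightarrow> 'b sgraph \<Rightarrow> nat" where
  "ramsey_number G1 G2 =
     (LEAST p. \<forall>f. edge_coloring 2 p f \<longrightarrow> has_mono_copy p f 1 G1 \<or> has_mono_copy p f 2 G2)"

text \<open>Intended for \<open>1 \<le> s < t\<close>.\<close>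

definition weak_gallai_ramsey :: "nat \<Rightarrow> nat \<Rightarrow> 'a sgraph \<Rightarrow> nat" where
  "weak_gallai_ramsey t s G =
     (LEAST p. \<forall>f. gallai_coloring t p f \<longrightarrow> has_copy_with_at_most p f s G)"

end

theory Submission
  imports Defs
begin

text \<open>Take two copies of the given 2-coloring of \<open>K\<^sub>k\<close> and give color 3 to all edges between them;
  this is a Gallai coloring of \<open>K\<^sub>2\<^sub>k\<close>. Consider a copy of \<open>B\<^sub>n\<^sub>+\<^sub>k\<close> in at most two colors. If its
  spine lies in one half, then some page lies in the other half, so the pages in the half of the
  spine complete a monochromatic book and number less than \<open>n\<close>, while the other half has only \<open>k\<close>
  vertices. If the spine joins the two halves, then it has color 3, so in each half the pages are
  neighbors in one and the same color of the spine vertex there, and the star condition bounds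
  their number by \<open>\<lfloor>(n + k - 1) / 2\<rfloor>\<close> per half.\<close>

section \<open>From counts of neighbors to copies of stars and books\<close>

lemma has_mono_copy_star:
  assumes "a < p" "S \<subseteq> {..<p} - {a}" "m \<le> card S" "\<And>b. b \<in> S \<Longrightarrow> f {a, b} = c"
  shows "has_mono_copy p f c (star m)"
proof -
  have "finite S" using assms(2) finite_subset by blast
  then obtain h where h: "h ` {1..m} \<subseteq> S" "inj_on h {1..m}"
    using card_le_inj[of "{1..m}" S] assms(3) by auto
  define \<phi> where "\<phi> = h(0 := a)"
  have vertices: "vertices (star m) = insert 0 {1..m}"
    by (auto simp: star_def)
  have hS: "h i \<in> S" if "i \<in> {1..m}" for i using h(1) that by blast
  have \<phi>_eq: "\<phi> i = h i" if "i \<in> {1..m}" for i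
    using that by (simp add: \<phi>_def)
  have "inj_on \<phi> {1..m} = inj_on h {1..m}"
    by (rule inj_on_cong) (rule \<phi>_eq)
  with h(2) have "inj_on \<phi> {1..m}" by simp
  moreover have "\<phi> ` {1..m} \<subseteq> S"
    using hS \<phi>_eq by fastforce
  moreover have "\<phi> 0 = a" by (simp add: \<phi>_def)
  ultimately have "copy_in_complete p (star m) \<phi>"
    using assms(1,2) unfolding copy_in_complete_def vertices inj_on_insert by auto
  moreover have "f (\<phi> ` {0, i}) = c" if "i \<in> {1..m}" for i
    using assms(4)[OF hS[OF that]] that by (simp add: insert_commute \<phi>_def)
  then have "\<forall>e\<in>edges (star m). f (\<phi> ` e) = c"
    unfolding star_def by auto
  ultimately show ?thesis unfolding has_mono_copy_def by blast
qed

lemma has_mono_copy_book: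
  assumes "x < p" "y < p" "x \<noteq> y" "S \<subseteq> {..<p} - {x, y}" "n \<le> card S" "f {x, y} = c"
    "\<And>z. z \<in> S \<Longrightarrow> f {x, z} = c \<and> f {y, z} = c"
  shows "has_mono_copy p f c (book n)"
proof -
  have "finite S" using assms(4) finite_subset by blast
  then obtain h where h: "h ` {2..<n + 2} \<subseteq> S" "inj_on h {2..<n + 2}"
    using card_le_inj[of "{2..<n + 2}" S] assms(5) by auto
  define \<phi> where "\<phi> = h(0 := x, 1 := y)"
  have vertices: "vertices (book n) = insert 0 (insert 1 {2..<n + 2})"
    by (auto simp: book_def)
  have hS: "h i \<in> S" if "i \<in> {2..<n + 2}" for i using h(1) that by blast
  have "inj_on \<phi> {2..<n + 2}"
    using h(2) by (auto simp: \<phi>_def inj_on_def)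
  moreover have im: "\<phi> ` {2..<n + 2} \<subseteq> S"
    using h(1) by (auto simp: \<phi>_def)
  moreover have "\<phi> 0 = x" "\<phi> 1 = y" by (auto simp: \<phi>_def)
  ultimately have "copy_in_complete p (book n) \<phi>"
    using assms(1-4) unfolding copy_in_complete_def vertices inj_on_insert by auto
  moreover have "f {x, h i} = c" "f {y, h i} = c" "f {h i, x} = c" "f {h i, y} = c"
    if "i \<in> {2..<n + 2}" for i
    using assms(7)[OF hS[OF that]] by (simp_all add: insert_commute)
  then have "\<forall>e\<in>edges (book n). f (\<phi> ` e) = c"
    using assms(6) by (auto simp: book_def \<phi>_def)
  ultimately show ?thesis unfolding has_mono_copy_def by blast
qed

section \<open>Existence of weakened Gallai-Ramsey numbers\<close>

text \<open>Ramsey's theorem for \<open>t\<close> colors gives a monochromatic clique with as many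
  vertices as \<open>G\<close>, and any bijection onto it places \<open>G\<close> in at most one
  color. This is needed for the lower bound: \<open>LEAST\<close> of an unsatisfiable predicate has
  no known value.\<close>

lemma weak_gallai_ramsey_exists:
  fixes G :: "'a sgraph"
  assumes fin: "finite (vertices G)"
    and edges: "\<And>e. e \<in> edges G \<Longrightarrow> e \<subseteq> vertices G \<and> card e = 2"
    and "1 \<le> s"
  shows "\<exists>p. \<forall>f. gallai_coloring t p f \<longrightarrow> has_copy_with_at_most p f s G"
proof -
  define q where "q = card (vertices G)"
  obtain N :: nat where N: "partn_lst {..<N} (replicate t q) 2"
    using ramsey_full by blast
  have "has_copy_with_at_most N f s G" if f: "gallai_coloring t N f" for f
  proof -
    have range: "f e \<in> {1..t}" if "e \<in> nsets {..<N} 2" for e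
      using f that unfolding gallai_coloring_def edge_coloring_def by blast
    \<comment> \<open>\<open>partn_lst\<close> counts colors from 0, hence the shift. As
      \<open>f\<close> is at least 1 on edges, the truncated subtraction can be undone
      below.\<close>
    have "(\<lambda>e. f e - 1) \<in> [{..<N}]\<^bsup>2\<^esup> \<rightarrow> {..<length (replicate t q)}"
    proof
      fix e assume "e \<in> nsets {..<N} 2"
      from range[OF this] show "f e - 1 \<in> {..<length (replicate t q)}" by auto
    qed
    from partn_lstE[OF N this] obtain i H where
      i: "i < t" and H: "H \<in> nsets {..<N} q" and mono: "(\<lambda>e. f e - 1) ` nsets H 2 \<subseteq> {i}"
      by (metis length_replicate nth_replicate)
    have Hp: "H \<subseteq> {..<N}" "finite H" "card H = q" using H by (auto simp: nsets_def)
    obtain \<phi> where \<phi>: "bij_betw \<phi> (vertices G) H"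
      using finite_same_card_bij[OF fin Hp(2)] Hp(3) q_def by auto
    have "f (\<phi> ` e) = i + 1" if "e \<in> edges G" for e
    proof -
      have e: "e \<subseteq> vertices G" "card e = 2" using edges that by auto
      have "card (\<phi> ` e) = 2" "\<phi> ` e \<subseteq> H"
        using \<phi> e card_image inj_on_subset unfolding bij_betw_def by (metis, blast)
      then have "\<phi> ` e \<in> nsets H 2" "\<phi> ` e \<in> nsets {..<N} 2"
        using Hp by (auto simp: nsets_def card_ge_0_finite)
      then have "f (\<phi> ` e) - 1 = i" "f (\<phi> ` e) \<in> {1..t}"
        using mono range by blast+
      then show ?thesis by auto
    qed
    then have "(\<lambda>e. f (\<phi> ` e)) ` edges G \<subseteq> {i + 1}" by blast
    from card_mono[OF _ this] have "card ((\<lambda>e. f (\<phi> ` e)) ` edges G) \<le> s"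
      using \<open>1 \<le> s\<close> by simp
    moreover have "copy_in_complete N G \<phi>"
      using \<phi> Hp(1) unfolding copy_in_complete_def bij_betw_def by auto
    ultimately show ?thesis unfolding has_copy_with_at_most_def by blast
  qed
  then show ?thesis by blast
qed

section \<open>The doubled coloring\<close>

text \<open>The halves are \<open>{..<k}\<close> and \<open>{k..<2 * k}\<close>, and
  \<open>a mod k\<close> sends each vertex to the vertex of the original graph that it duplicates.
  Color 3 is new, as \<open>f\<close> uses only 1 and 2 on edges.\<close>

definition double_coloring :: "nat \<Rightarrow> (nat set \<Rightarrow> nat) \<Rightarrow> nat set \<Rightarrow> nat" where
  "double_coloring k f e =
     (if \<exists>a\<in>e. \<exists>b\<in>e. a < k \<and> \<not> b < k then 3 else f ((\<lambda>a. a mod k) ` e))"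

lemma double_coloring_pair:
  "double_coloring k f {a, b} = (if (a < k) = (b < k) then f {a mod k, b mod k} else 3)"
  unfolding double_coloring_def by simp

text \<open>Within a half, reduction mod \<open>k\<close> subtracts a constant, 0 or
  \<open>k\<close>. So each half is a faithful copy of the original graph, and pages in one half can
  be counted after projection.\<close>

lemma mod_eq_same_half:
  fixes a b k :: nat
  assumes "a < 2 * k" "b < 2 * k" "(a < k) = (b < k)" "a mod k = b mod k"
  shows "a = b"
proof (cases "a < k")
  case False
  then have "a mod k = a - k" "b mod k = b - k"
    using assms by (auto simp: le_mod_geq)
  then show ?thesis using False assms by auto
qed (use assms in auto)

lemma edge_coloring_pair:
  assumes "edge_coloring t p f" "a < p" "b < p" "a \<noteq> b"
  shows "f {a, b} \<in> {1..t}"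
proof -
  have "{a, b} \<in> nsets {..<p} 2" using assms by (auto simp: nsets_def)
  then show ?thesis using assms(1) unfolding edge_coloring_def by blast
qed

lemma double_coloring_same_half:
  assumes "edge_coloring 2 k f" "a < 2 * k" "b < 2 * k" "a \<noteq> b" "(a < k) = (b < k)"
  shows "double_coloring k f {a, b} \<in> {1, 2}"
proof -
  have "a mod k \<noteq> b mod k" "0 < k" using mod_eq_same_half assms by auto
  then have "f {a mod k, b mod k} \<in> {1..2}"
    using edge_coloring_pair[OF assms(1)] by simp
  then show ?thesis using assms(5) by (auto simp: double_coloring_pair)
qed

text \<open>A triangle inside one half sees only colors 1 and 2; any other triangle has two edges
  between the halves, both of color 3.\<close>

lemma gallai_double_coloring:
  assumes "edge_coloring 2 k f" "3 \<le> t" "p \<le> 2 * k"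
  shows "gallai_coloring t p (double_coloring k f)"
proof -
  let ?g = "double_coloring k f"
  have same: "?g {a, b} \<in> {1, 2}" if "a < p" "b < p" "a \<noteq> b" "(a < k) = (b < k)" for a b
    using double_coloring_same_half[OF assms(1)] that assms(3) by simp
  have diff: "?g {a, b} = 3" if "(a < k) \<noteq> (b < k)" for a b
    using that by (simp add: double_coloring_pair)
  have "?g e \<in> {1..t}" if "e \<in> nsets {..<p} 2" for e
  proof -
    obtain a b where "e = {a, b}" "a \<noteq> b" "a < p" "b < p"
      using \<open>e \<in> nsets {..<p} 2\<close> by (auto simp: nsets_def card_2_iff)
    then show ?thesis using same[of a b] diff[of a b] assms(2) by fastforce
  qed
  then have "edge_coloring t p ?g" unfolding edge_coloring_def by blast
  moreover have "?g {x, y} = ?g {x, z} \<or> ?g {x, y} = ?g {y, z} \<or> ?g {x, z} = ?g {y, z}"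
    if "x < p" "y < p" "z < p" "x \<noteq> y" "x \<noteq> z" "y \<noteq> z" for x y z
  proof (cases "(x < k) = (y < k) \<and> (y < k) = (z < k)")
    case True
    then have "?g {x, y} \<in> {1, 2}" "?g {x, z} \<in> {1, 2}" "?g {y, z} \<in> {1, 2}"
      using same that by auto
    then show ?thesis by auto
  next
    case False
    then show ?thesis using diff by metis
  qed
  ultimately show ?thesis unfolding gallai_coloring_def by blast
qed

section \<open>Excluding large books in two colors\<close>

lemma book_in_double_coloring_colors:
  assumes f: "edge_coloring 2 k f"
    and book: "\<And>c. c \<in> {1, 2} \<Longrightarrow> \<not> has_mono_copy k f c (book n)"
    and star: "\<And>c. c \<in> {1, 2} \<Longrightarrow> \<not> has_mono_copy k f c (star ((n + k - 1) div 2 + 1))"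
    and n: "1 \<le> n" and p: "p \<le> 2 * k"
  shows "\<not> has_copy_with_at_most p (double_coloring k f) 2 (book (n + k))"
proof
  let ?g = "double_coloring k f" and ?N = "n + k"
  assume "has_copy_with_at_most p ?g 2 (book ?N)"
  then obtain \<phi> where inj: "inj_on \<phi> {..<?N + 2}" and im: "\<phi> ` {..<?N + 2} \<subseteq> {..<p}"
    and card2: "card ((\<lambda>e. ?g (\<phi> ` e)) ` edges (book ?N)) \<le> 2"
    unfolding has_copy_with_at_most_def copy_in_complete_def
    by (auto simp: book_def)
  define C where "C = (\<lambda>e. ?g (\<phi> ` e)) ` edges (book ?N)"
  define x where "x = \<phi> 0"
  define y where "y = \<phi> 1"
  define P where "P = \<phi> ` {2..<?N + 2}"
  have less: "\<phi> i < 2 * k" if "i < ?N + 2" for i using im p that by fastforce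
  have xy: "x < 2 * k" "y < 2 * k" "x \<noteq> y"
    using less inj n by (auto simp: x_def y_def inj_on_def)
  have "inj_on \<phi> {2..<?N + 2}" by (rule inj_on_subset[OF inj]) auto
  then have cardP: "card P = ?N" by (simp add: P_def card_image)
  have P: "z < 2 * k" "z \<noteq> x" "z \<noteq> y" if "z \<in> P" for z
    using that less inj_on_eq_iff[OF inj] by (auto simp: P_def x_def y_def)
  have finP: "finite P" by (simp add: P_def)
  have gxy: "?g {x, y} \<in> C"
    by (force simp: C_def book_def x_def y_def)
  have gP: "?g {x, z} \<in> C" "?g {y, z} \<in> C" if z: "z \<in> P" for z
  proof -
    obtain i where i: "i \<in> {2..<?N + 2}" "z = \<phi> i" using z by (auto simp: P_def)
    then have "{0, i} \<in> edges (book ?N)" "{1, i} \<in> edges (book ?N)"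
      by (auto simp: book_def)
    from this[THEN imageI[of _ _ "\<lambda>e. ?g (\<phi> ` e)"]]
    show "?g {x, z} \<in> C" "?g {y, z} \<in> C"
      by (simp_all add: C_def x_def y_def i)
  qed
  \<comment> \<open>An infinite set has \<open>card\<close> 0, so the bound on \<open>card C\<close>
    says something only once \<open>C\<close> is known to be finite.\<close>
  have "edges (book ?N) \<subseteq> Pow {..<?N + 2}" by (auto simp: book_def)
  then have finC: "finite C" unfolding C_def by (meson finite_Pow_iff finite_imageI finite_lessThan finite_subset)
  have cardC: "card C \<le> 2" using card2 by (simp add: C_def)
  have k0: "0 < k" using xy by auto
  have same: "?g {a, b} \<in> {1, 2}" "?g {a, b} = f {a mod k, b mod k}" "a mod k \<noteq> b mod k"
    if "a < 2 * k" "b < 2 * k" "a \<noteq> b" "(a < k) = (b < k)" for a b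
    using double_coloring_same_half[OF f] mod_eq_same_half that
    by (auto simp: double_coloring_pair)
  have card_half: "card ((\<lambda>a. a mod k) ` Q) = card Q"
    if "Q \<subseteq> {..<2 * k}" "\<And>a b. a \<in> Q \<Longrightarrow> b \<in> Q \<Longrightarrow> (a < k) = (b < k)" for Q
    by (rule card_image, rule inj_onI) (use that mod_eq_same_half in blast)
  have card_le: "card Q \<le> k"
    if "Q \<subseteq> {..<2 * k}" "\<And>a b. a \<in> Q \<Longrightarrow> b \<in> Q \<Longrightarrow> (a < k) = (b < k)" for Q
    using card_half[OF that] card_mono[of "{..<k}" "(\<lambda>a. a mod k) ` Q"] k0 by fastforce
  \<comment> \<open>Pages are split by the half of \<open>x\<close>. If the spine joins the halves,
    \<open>PB\<close> consists of the pages in the half of \<open>y\<close>.\<close>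
  define PA where "PA = {z \<in> P. (z < k) = (x < k)}"
  define PB where "PB = {z \<in> P. (z < k) \<noteq> (x < k)}"
  have "P = PA \<union> PB" "PA \<inter> PB = {}" by (auto simp: PA_def PB_def)
  then have card_sum: "card PA + card PB = ?N"
    using finP cardP by (metis card_Un_disjoint finite_Un)
  have PA: "PA \<subseteq> {..<2 * k}" "card PA \<le> k" "card ((\<lambda>a. a mod k) ` PA) = card PA"
  proof -
    show *: "PA \<subseteq> {..<2 * k}" using P(1) by (auto simp: PA_def)
    show "card PA \<le> k" by (rule card_le[OF *]) (auto simp: PA_def)
    show "card ((\<lambda>a. a mod k) ` PA) = card PA"
      by (rule card_half[OF *]) (auto simp: PA_def)
  qed
  have PB: "PB \<subseteq> {..<2 * k}" "card PB \<le> k" "card ((\<lambda>a. a mod k) ` PB) = card PB"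
  proof -
    show *: "PB \<subseteq> {..<2 * k}" using P(1) by (auto simp: PB_def)
    show "card PB \<le> k" by (rule card_le[OF *]) (auto simp: PB_def)
    show "card ((\<lambda>a. a mod k) ` PB) = card PB"
      by (rule card_half[OF *]) (auto simp: PB_def)
  qed
  have C3: "3 \<in> C"
  proof (cases "(x < k) = (y < k)")
    case True
    \<comment> \<open>The half of the spine has room for at most \<open>k\<close> of the
      \<open>n + k\<close> pages.\<close>
    have "PB \<noteq> {}" using card_sum PA(2) n by auto
    then obtain z where "z \<in> P" "(x < k) \<noteq> (z < k)" by (auto simp: PB_def)
    then show ?thesis using gP(1)[of z] by (simp add: double_coloring_pair)
  next
    case False
    then show ?thesis using gxy by (simp add: double_coloring_pair)
  qed
  \<comment> \<open>Color 3 takes one of the two available places in \<open>C\<close>, so every edge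
    of the copy that lies inside a half has the same color \<open>c\<close>, whichever half it is.
    If neither 1 nor 2 occurs in \<open>C\<close>, either can serve as \<open>c\<close>.\<close>
  obtain c where c: "c \<in> {1, 2}" "C \<inter> {1, 2} \<subseteq> {c}"
  proof -
    have "\<not> {1, 2, 3} \<subseteq> C"
      using card_mono[OF finC, of "{1, 2, 3}"] cardC by auto
    then have "1 \<notin> C \<or> 2 \<notin> C" using C3 by auto
    then show thesis using that[of 1] that[of 2] by blast
  qed
  have half_color: "f {a mod k, b mod k} = c"
    if "?g {a, b} \<in> C" "a < 2 * k" "b < 2 * k" "a \<noteq> b" "(a < k) = (b < k)" for a b
    using same[OF that(2-5)] that(1) c by (metis IntI subsetD singletonD)
  show False
  proof (cases "(x < k) = (y < k)")
    case True
    have "has_mono_copy k f c (book n)"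
    proof (rule has_mono_copy_book)
      show "x mod k < k" "y mod k < k" using k0 by auto
      show "x mod k \<noteq> y mod k" using same(3) xy True by blast
      show "(\<lambda>a. a mod k) ` PA \<subseteq> {..<k} - {x mod k, y mod k}"
        using same(3) P xy True k0 by (fastforce simp: PA_def)
      \<comment> \<open>At most \<open>k\<close> of the \<open>n + k\<close> pages lie in the other
        half.\<close>
      show "n \<le> card ((\<lambda>a. a mod k) ` PA)"
        using card_sum PA(3) PB(2) by linarith
      show "f {x mod k, y mod k} = c" using half_color gxy xy True by blast
      show "f {x mod k, z} = c \<and> f {y mod k, z} = c" if z: "z \<in> (\<lambda>a. a mod k) ` PA" for z
      proof -
        obtain w where "w \<in> P" "(x < k) = (w < k)" "z = w mod k"
          using z by (auto simp: PA_def)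
        then show ?thesis
          using half_color[OF gP(1)] half_color[OF gP(2)] P xy True by metis
      qed
    qed
    then show False using book c by blast
  next
    case False
    \<comment> \<open>Here \<open>s\<close> is a spine vertex and \<open>Q\<close> the set of pages
      in its half: the claim is applied to \<open>x\<close> with \<open>PA\<close> and to
      \<open>y\<close> with \<open>PB\<close>.\<close>
    have bound: "card Q \<le> (n + k - 1) div 2"
      if s: "s < 2 * k" and Q: "Q \<subseteq> {..<2 * k}"
        "card ((\<lambda>a. a mod k) ` Q) = card Q" "\<And>z. z \<in> Q \<Longrightarrow> z \<noteq> s \<and> (s < k) = (z < k)"
        "\<And>z. z \<in> Q \<Longrightarrow> ?g {s, z} \<in> C" for s Q
    proof (rule ccontr)
      assume *: "\<not> card Q \<le> (n + k - 1) div 2"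
      have "has_mono_copy k f c (star ((n + k - 1) div 2 + 1))"
      proof (rule has_mono_copy_star)
        show "s mod k < k" using k0 by auto
        show "(\<lambda>a. a mod k) ` Q \<subseteq> {..<k} - {s mod k}"
          using same(3) s Q(1,3) k0 by fastforce
        show "(n + k - 1) div 2 + 1 \<le> card ((\<lambda>a. a mod k) ` Q)"
          using * Q(2) by linarith
        show "f {s mod k, b} = c" if b: "b \<in> (\<lambda>a. a mod k) ` Q" for b
        proof -
          obtain w where w: "w \<in> Q" "b = w mod k" using b by auto
          then show ?thesis using half_color[OF Q(4)[OF w(1)]] s Q(1,3) by blast
        qed
      qed
      then show False using star c by blast
    qed
    have "card PA \<le> (n + k - 1) div 2"
      by (rule bound[OF xy(1) PA(1,3)]) (auto simp: PA_def P gP)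
    moreover have "card PB \<le> (n + k - 1) div 2"
      by (rule bound[OF xy(2) PB(1,3)]) (use False in \<open>auto simp: PB_def P gP\<close>)
    \<comment> \<open>Two such bounds add up to at most \<open>n + k - 1\<close>, one short of the
      number of pages.\<close>
    ultimately show False using card_sum n by linarith
  qed
qed

theorem theorem2p7:
  fixes n t k :: nat
  assumes "n \<ge> 2" and "t \<ge> 3" and "k < ramsey_number (book n) (book n)"
    and "\<exists>f. edge_coloring 2 k f \<and>
           (\<forall>c\<in>{1, 2}. \<not> has_mono_copy k f c (book n) \<and>
                        \<not> has_mono_copy k f c (star ((n + k - 1) div 2 + 1)))"
  shows "weak_gallai_ramsey t 2 (book (n + k)) \<ge> 2 * k + 1"
proof -
  let ?good = "\<lambda>p. \<forall>g. gallai_coloring t p g \<longrightarrow> has_copy_with_at_most p g 2 (book (n + k))"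
  obtain f where f: "edge_coloring 2 k f"
    and avoid: "\<And>c. c \<in> {1, 2} \<Longrightarrow> \<not> has_mono_copy k f c (book n)"
      "\<And>c. c \<in> {1, 2} \<Longrightarrow> \<not> has_mono_copy k f c (star ((n + k - 1) div 2 + 1))"
    using assms(4) by blast
  have "\<exists>p. ?good p"
    by (rule weak_gallai_ramsey_exists) (auto simp: book_def)
  then have "?good (LEAST p. ?good p)" by (rule LeastI_ex)
  \<comment> \<open>Treating every \<open>p \<le> 2 * k\<close> directly, by restricting the doubled
    coloring to \<open>{..<p}\<close>, avoids showing that \<open>?good\<close> is monotone in
    \<open>p\<close>.\<close>
  moreover have "\<not> ?good p" if "p \<le> 2 * k" for p
    using gallai_double_coloring[OF f assms(2) that] assms(1)
      book_in_double_coloring_colors[OF f avoid _ that] by auto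
  ultimately have "\<not> (LEAST p. ?good p) \<le> 2 * k" by blast
  then show ?thesis unfolding weak_gallai_ramsey_def by linarith
qed

end
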